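(* Let $S$ be a semigroup and let $Q_1$, $Q_2$ be primitive inverse semigroups of left I-quotients of $S$. Then $Q_1$ and $Q_2$ are isomorphic by an isomorphism which restricts to the identity map on $S$.
   Context: An inverse semigroup $Q$ with zero is primitive if every nonzero idempotent $e$ of $Q$ is primitive, i.e. for every idempotent $f$, $f\le e$ (that is, $ef=fe=f$) implies $f=0$ or $f=e$. For a subsemigroup $S$ of an inverse semigroup $Q$, $Q$ is a semigroup of left I-quotients of $S$ if every $q\in Q$ can be written as $q=a^{-1}b$ with $a,b\in S$, where $a^{-1}$ is the inverse of $a$ in the inverse semigroup $Q$. *)

theory Defs
  imports "HOL-Algebra.Group"
begin

text \<open>
  Semigroups are carried by the \<^typ>\<open>'a monoid\<close> record of HOL-Algebra, so that
  \<^const>\<open>hom\<close> and \<^const>\<open>iso\<close> apply. The field \<^const>\<open>one\<close> is never constrained or used: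
  these semigroups need not have an identity. In particular \<^const>\<open>m_inv\<close>, which refers
  to \<^const>\<open>one\<close>, is not the inverse meant here.
\<close>

locale sgrp =
  fixes Q (structure)
  assumes m_closed: "\<lbrakk>x \<in> carrier Q; y \<in> carrier Q\<rbrakk> \<Longrightarrow> x \<otimes> y \<in> carrier Q"
    and m_assoc: "\<lbrakk>x \<in> carrier Q; y \<in> carrier Q; z \<in> carrier Q\<rbrakk>
      \<Longrightarrow> (x \<otimes> y) \<otimes> z = x \<otimes> (y \<otimes> z)"

definition subsemigroup :: "('a, 's) monoid_scheme \<Rightarrow> ('a, 'q) monoid_scheme \<Rightarrow> bool" where
  "subsemigroup S Q \<longleftrightarrow> sgrp S \<and> sgrp Q \<and> carrier S \<subseteq> carrier Q \<and>
    (\<forall>x\<in>carrier S. \<forall>y\<in>carrier S. x \<otimes>\<^bsub>S\<^esub> y = x \<otimes>\<^bsub>Q\<^esub> y)"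

definition is_sg_inverse :: "('a, 'q) monoid_scheme \<Rightarrow> 'a \<Rightarrow> 'a \<Rightarrow> bool" where
  "is_sg_inverse Q a b \<longleftrightarrow> b \<in> carrier Q \<and>
    a \<otimes>\<^bsub>Q\<^esub> b \<otimes>\<^bsub>Q\<^esub> a = a \<and> b \<otimes>\<^bsub>Q\<^esub> a \<otimes>\<^bsub>Q\<^esub> b = b"

locale inverse_semigroup = sgrp +
  assumes ex1_inverse: "a \<in> carrier Q \<Longrightarrow> \<exists>!b. is_sg_inverse Q a b"

definition sg_inv :: "('a, 'q) monoid_scheme \<Rightarrow> 'a \<Rightarrow> 'a" where
  "sg_inv Q a = (THE b. is_sg_inverse Q a b)"

definition is_zero :: "('a, 'q) monoid_scheme \<Rightarrow> 'a \<Rightarrow> bool" where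
  "is_zero Q z \<longleftrightarrow> z \<in> carrier Q \<and> (\<forall>x\<in>carrier Q. z \<otimes>\<^bsub>Q\<^esub> x = z \<and> x \<otimes>\<^bsub>Q\<^esub> z = z)"

definition idempotents :: "('a, 'q) monoid_scheme \<Rightarrow> 'a set" where
  "idempotents Q = {e \<in> carrier Q. e \<otimes>\<^bsub>Q\<^esub> e = e}"

definition idem_le :: "('a, 'q) monoid_scheme \<Rightarrow> 'a \<Rightarrow> 'a \<Rightarrow> bool" where
  "idem_le Q f e \<longleftrightarrow> e \<otimes>\<^bsub>Q\<^esub> f = f \<and> f \<otimes>\<^bsub>Q\<^esub> e = f"

definition primitive_idempotent :: "('a, 'q) monoid_scheme \<Rightarrow> 'a \<Rightarrow> bool" where
  "primitive_idempotent Q e \<longleftrightarrow> e \<in> idempotents Q \<and> \<not> is_zero Q e \<and>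
    (\<forall>f\<in>idempotents Q. idem_le Q f e \<longrightarrow> is_zero Q f \<or> f = e)"

locale primitive_inverse_semigroup = inverse_semigroup +
  assumes ex_zero: "\<exists>z. is_zero Q z"
    and primitive: "\<lbrakk>e \<in> idempotents Q; \<not> is_zero Q e\<rbrakk> \<Longrightarrow> primitive_idempotent Q e"

definition semigroup_of_left_I_quotients ::
    "('a, 'q) monoid_scheme \<Rightarrow> ('a, 's) monoid_scheme \<Rightarrow> bool" where
  "semigroup_of_left_I_quotients Q S \<longleftrightarrow> inverse_semigroup Q \<and> subsemigroup S Q \<and>
    (\<forall>q\<in>carrier Q. \<exists>a\<in>carrier S. \<exists>b\<in>carrier S. q = sg_inv Q a \<otimes>\<^bsub>Q\<^esub> b)"

end

theory Submission
  imports Defs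
begin

text \<open>
  In a primitive inverse semigroup, $xy \neq 0$ holds exactly when $x, y \neq 0$ and
  $x^{-1}x = yy^{-1}$. For elements of $S$ this turns the relevant cases of Green's relations in
  $Q$ into the non-vanishing of products in $S$; since $Q$ consists of quotients, enough
  multipliers exist in $S$ to detect them. Moreover the zero of $Q$ lies in $S$. Hence equality
  of quotients $a^{-1}b$ and their multiplication are determined by $S$ alone, so that
  $a^{-1}b \mapsto a^{-1}b$ is a well-defined isomorphism from $Q_1$ to $Q_2$.
\<close>

section \<open>Inverse semigroups: commuting idempotents and the inverse of a product\<close>

context inverse_semigroup
begin

abbreviation iv :: "'a \<Rightarrow> 'a" ("\<iota>") where "\<iota> \<equiv> sg_inv Q"

lemma is_sg_inverse_iv: "a \<in> carrier Q \<Longrightarrow> is_sg_inverse Q a (\<iota> a)"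
  unfolding sg_inv_def by (rule theI') (rule ex1_inverse)

lemma iv_closed [simp]: "a \<in> carrier Q \<Longrightarrow> \<iota> a \<in> carrier Q"
  using is_sg_inverse_iv by (auto simp: is_sg_inverse_def)

lemma closed [simp]: "x \<in> carrier Q \<Longrightarrow> y \<in> carrier Q \<Longrightarrow> x \<otimes> y \<in> carrier Q"
  by (rule m_closed)

lemma mult_iv_mult [simp]: "a \<in> carrier Q \<Longrightarrow> a \<otimes> (\<iota> a \<otimes> a) = a"
  using is_sg_inverse_iv[of a] by (auto simp: is_sg_inverse_def m_assoc)

lemma iv_mult_iv [simp]: "a \<in> carrier Q \<Longrightarrow> \<iota> a \<otimes> (a \<otimes> \<iota> a) = \<iota> a"
  using is_sg_inverse_iv[of a] by (auto simp: is_sg_inverse_def m_assoc)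

text \<open>With \<open>m_assoc\<close> as a rewrite rule, products are associated to the right, so
  the pattern $aa^{-1}a$ may be followed by a further factor. This variant cancels it there.\<close>

lemma mult_iv_mult_left [simp]:
  "a \<in> carrier Q \<Longrightarrow> y \<in> carrier Q \<Longrightarrow> a \<otimes> (\<iota> a \<otimes> (a \<otimes> y)) = a \<otimes> y"
  using mult_iv_mult[of a] by (metis m_assoc m_closed iv_closed)

lemma iv_mult_iv_left [simp]:
  "a \<in> carrier Q \<Longrightarrow> y \<in> carrier Q \<Longrightarrow> \<iota> a \<otimes> (a \<otimes> (\<iota> a \<otimes> y)) = \<iota> a \<otimes> y"
  using iv_mult_iv[of a] by (metis m_assoc m_closed iv_closed)

lemma iv_unique:
  assumes "a \<in> carrier Q" "b \<in> carrier Q" "a \<otimes> (b \<otimes> a) = a" "b \<otimes> (a \<otimes> b) = b"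
  shows "\<iota> a = b"
proof -
  have "is_sg_inverse Q a b"
    using assms by (simp add: is_sg_inverse_def m_assoc)
  then show ?thesis
    using ex1_inverse is_sg_inverse_iv assms(1) by blast
qed

lemma iv_iv [simp]: "a \<in> carrier Q \<Longrightarrow> \<iota> (\<iota> a) = a"
  by (rule iv_unique) auto

lemma mult_iv_idempotent [simp]: "a \<in> carrier Q \<Longrightarrow> a \<otimes> \<iota> a \<in> idempotents Q"
  by (simp add: idempotents_def m_assoc)

lemma iv_mult_idempotent [simp]: "a \<in> carrier Q \<Longrightarrow> \<iota> a \<otimes> a \<in> idempotents Q"
  by (simp add: idempotents_def m_assoc)

lemma iv_idempotent: "e \<in> idempotents Q \<Longrightarrow> \<iota> e = e"
  by (rule iv_unique) (auto simp: idempotents_def)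

text \<open>Let $x = (ef)^{-1}$. Then $fxe$ is an inverse of $ef$ as well, so $x = fxe$ by
  uniqueness. This form makes $x$ idempotent, hence its own inverse, and so $ef = x$.\<close>

lemma idempotent_mult:
  assumes "e \<in> idempotents Q" "f \<in> idempotents Q"
  shows "e \<otimes> f \<in> idempotents Q"
proof -
  have [simp]: "e \<in> carrier Q" "f \<in> carrier Q" and "e \<otimes> e = e" "f \<otimes> f = f"
    using assms by (auto simp: idempotents_def)
  then have [simp]: "e \<otimes> (e \<otimes> y) = e \<otimes> y" "f \<otimes> (f \<otimes> y) = f \<otimes> y"
    if "y \<in> carrier Q" for y
    using that by (metis m_assoc \<open>e \<in> carrier Q\<close> \<open>f \<in> carrier Q\<close>)+
  define x where "x = \<iota> (e \<otimes> f)"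
  have [simp]: "x \<in> carrier Q" by (simp add: x_def)
  have 1: "e \<otimes> (f \<otimes> (x \<otimes> (e \<otimes> f))) = e \<otimes> f"
    using mult_iv_mult[of "e \<otimes> f"] by (simp add: x_def m_assoc del: mult_iv_mult)
  have "x \<otimes> (e \<otimes> (f \<otimes> x)) = x"
    using iv_mult_iv[of "e \<otimes> f"] by (simp add: x_def m_assoc del: iv_mult_iv)
  then have 2: "x \<otimes> (e \<otimes> (f \<otimes> (x \<otimes> y))) = x \<otimes> y" if "y \<in> carrier Q" for y
    using that by (metis m_assoc m_closed \<open>x \<in> carrier Q\<close> \<open>e \<in> carrier Q\<close> \<open>f \<in> carrier Q\<close>)
  have x: "x = f \<otimes> (x \<otimes> e)"
    unfolding x_def by (rule iv_unique) (simp_all add: m_assoc 1 2 flip: x_def)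
  have "x \<otimes> x = (f \<otimes> (x \<otimes> e)) \<otimes> (f \<otimes> (x \<otimes> e))"
    by (rule arg_cong2[OF x x])
  also have "\<dots> = f \<otimes> (x \<otimes> e)"
    by (simp add: m_assoc 2)
  also have "\<dots> = x"
    by (rule x[symmetric])
  finally have "x \<otimes> x = x" .
  then have "x \<in> idempotents Q" by (simp add: idempotents_def)
  moreover from this have "\<iota> x = x" by (rule iv_idempotent)
  then have "e \<otimes> f = x" by (simp add: x_def)
  ultimately show ?thesis by simp
qed

text \<open>Since $ef$ and $fe$ are idempotent, they are inverse to each other. But the idempotent
  $ef$ is its own inverse, and inverses are unique.\<close>

lemma idempotent_commute:
  assumes "e \<in> idempotents Q" "f \<in> idempotents Q"
  shows "e \<otimes> f = f \<otimes> e"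
proof -
  have [simp]: "e \<in> carrier Q" "f \<in> carrier Q" and ee: "e \<otimes> e = e" "f \<otimes> f = f"
    using assms by (auto simp: idempotents_def)
  then have [simp]: "e \<otimes> (e \<otimes> y) = e \<otimes> y" "f \<otimes> (f \<otimes> y) = f \<otimes> y"
    if "y \<in> carrier Q" for y
    using that by (metis m_assoc \<open>e \<in> carrier Q\<close> \<open>f \<in> carrier Q\<close>)+
  have "e \<otimes> f \<in> idempotents Q" "f \<otimes> e \<in> idempotents Q"
    using assms by (simp_all add: idempotent_mult)
  then have "e \<otimes> (f \<otimes> (e \<otimes> f)) = e \<otimes> f" "f \<otimes> (e \<otimes> (f \<otimes> e)) = f \<otimes> e"
    by (simp_all add: idempotents_def m_assoc)
  then have "\<iota> (e \<otimes> f) = f \<otimes> e"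
    by (intro iv_unique) (simp_all add: m_assoc)
  then show ?thesis
    using iv_idempotent idempotent_mult assms by metis
qed

lemma iv_mult:
  assumes [simp]: "x \<in> carrier Q" "y \<in> carrier Q"
  shows "\<iota> (x \<otimes> y) = \<iota> y \<otimes> \<iota> x"
proof (rule iv_unique)
  \<comment> \<open>The idempotents $x^{-1}x$ and $yy^{-1}$ commute; the trailing factor $t$ makes
    the swap applicable inside right-associated products.\<close>
  have comm: "\<iota> x \<otimes> (x \<otimes> (y \<otimes> (\<iota> y \<otimes> t))) = y \<otimes> (\<iota> y \<otimes> (\<iota> x \<otimes> (x \<otimes> t)))"
    if "t \<in> carrier Q" for t
  proof -
    have "(\<iota> x \<otimes> x) \<otimes> (y \<otimes> \<iota> y) \<otimes> t = (y \<otimes> \<iota> y) \<otimes> (\<iota> x \<otimes> x) \<otimes> t"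
      by (simp add: idempotent_commute)
    then show ?thesis
      using that by (simp add: m_assoc)
  qed
  show "x \<otimes> y \<otimes> (\<iota> y \<otimes> \<iota> x \<otimes> (x \<otimes> y)) = x \<otimes> y"
    by (simp add: m_assoc comm[of y, symmetric])
  show "\<iota> y \<otimes> \<iota> x \<otimes> (x \<otimes> y \<otimes> (\<iota> y \<otimes> \<iota> x)) = \<iota> y \<otimes> \<iota> x"
    by (simp add: m_assoc comm[of "\<iota> x"])
qed simp_all

end

section \<open>Primitive inverse semigroups: when a product vanishes, and cancellation when it does
  not\<close>

context primitive_inverse_semigroup
begin

lemma is_zero_mult:
  assumes "is_zero Q z" "x \<in> carrier Q"
  shows "is_zero Q (z \<otimes> x)" "is_zero Q (x \<otimes> z)"
  using assms by (auto simp: is_zero_def)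

lemma is_zero_unique: "is_zero Q z \<Longrightarrow> is_zero Q w \<Longrightarrow> z = w"
  unfolding is_zero_def by metis

text \<open>The product $ef$ is an idempotent below both $e$ and $f$. If it is nonzero, primitivity
  makes it equal to each of them.\<close>

lemma idempotent_eq_if_mult_nonzero:
  assumes "e \<in> idempotents Q" "f \<in> idempotents Q" "\<not> is_zero Q (e \<otimes> f)"
  shows "e = f"
proof -
  have c: "e \<in> carrier Q" "f \<in> carrier Q" "e \<otimes> e = e" "f \<otimes> f = f"
    using assms by (auto simp: idempotents_def)
  then have "\<not> is_zero Q e" "\<not> is_zero Q f"
    using is_zero_mult assms(3) by blast+
  then have "primitive_idempotent Q e" "primitive_idempotent Q f"
    using primitive assms by auto
  moreover have "idem_le Q (e \<otimes> f) e" "idem_le Q (e \<otimes> f) f"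
    using c idempotent_commute[OF assms(1,2)] unfolding idem_le_def by (metis m_assoc)+
  ultimately have "e \<otimes> f = e" "e \<otimes> f = f"
    using idempotent_mult[OF assms(1,2)] assms(3) unfolding primitive_idempotent_def by blast+
  then show ?thesis by simp
qed

text \<open>Because $x = x(x^{-1}x) = (xx^{-1})x$ and $x^{-1} = x^{-1}xx^{-1}$, vanishing passes
  between all these elements.\<close>

lemma is_zero_iv_mult:
  assumes "x \<in> carrier Q"
  shows "is_zero Q (\<iota> x \<otimes> x) \<longleftrightarrow> is_zero Q x" "is_zero Q (x \<otimes> \<iota> x) \<longleftrightarrow> is_zero Q x"
    "is_zero Q (\<iota> x) \<longleftrightarrow> is_zero Q x"
proof -
  have "is_zero Q x" if "is_zero Q (\<iota> x \<otimes> x)"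
    using is_zero_mult(2)[OF that assms] assms by simp
  moreover have "is_zero Q x" if "is_zero Q (x \<otimes> \<iota> x)"
    using is_zero_mult(1)[OF that assms] assms by (simp add: m_assoc)
  moreover have "is_zero Q (\<iota> x)" if "is_zero Q x"
    using is_zero_mult(2)[OF is_zero_mult(1)[OF that], of "\<iota> x" "\<iota> x"] assms by simp
  ultimately show "is_zero Q (\<iota> x \<otimes> x) \<longleftrightarrow> is_zero Q x"
    "is_zero Q (x \<otimes> \<iota> x) \<longleftrightarrow> is_zero Q x" "is_zero Q (\<iota> x) \<longleftrightarrow> is_zero Q x"
    using is_zero_mult[OF _ assms] is_zero_mult[OF _ iv_closed[OF assms]] by metis+
qed

text \<open>Inserting idempotents gives $xy = x(x^{-1}x)(yy^{-1})y$, so a nonzero $xy$ forces the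
  two middle idempotents to agree. Conversely, if they agree, then $(xy)y^{-1} = x$, which is
  nonzero.\<close>

lemma mult_nonzero_iff:
  assumes [simp]: "x \<in> carrier Q" "y \<in> carrier Q"
  shows "\<not> is_zero Q (x \<otimes> y) \<longleftrightarrow>
    \<not> is_zero Q x \<and> \<not> is_zero Q y \<and> \<iota> x \<otimes> x = y \<otimes> \<iota> y" (is "?L \<longleftrightarrow> ?R")
proof
  assume ?L
  have "x \<otimes> y = x \<otimes> ((\<iota> x \<otimes> x \<otimes> (y \<otimes> \<iota> y)) \<otimes> y)"
    by (simp add: m_assoc)
  then have "\<not> is_zero Q (\<iota> x \<otimes> x \<otimes> (y \<otimes> \<iota> y))"
    using \<open>?L\<close> is_zero_mult assms m_closed by metis
  then have "\<iota> x \<otimes> x = y \<otimes> \<iota> y"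
    by (intro idempotent_eq_if_mult_nonzero) simp_all
  then show ?R
    using \<open>?L\<close> is_zero_mult assms by blast
next
  assume ?R
  have "(x \<otimes> y) \<otimes> \<iota> y = x \<otimes> (y \<otimes> \<iota> y)"
    by (simp add: m_assoc)
  also have "y \<otimes> \<iota> y = \<iota> x \<otimes> x"
    using \<open>?R\<close> by simp
  finally have "(x \<otimes> y) \<otimes> \<iota> y = x"
    by simp
  then show ?L
    using \<open>?R\<close> is_zero_mult(1)[of "x \<otimes> y" "\<iota> y"] by auto
qed

text \<open>Nonvanishing of $xy$ gives $x^{-1}x = yy^{-1}$, which is a left identity for $y$. This
  is the cancellation law behind all later computations with quotients.\<close>

lemma iv_mult_cancel:
  assumes "\<not> is_zero Q (x \<otimes> y)" and [simp]: "x \<in> carrier Q" "y \<in> carrier Q"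
  shows "\<iota> x \<otimes> (x \<otimes> y) = y"
proof -
  have "\<iota> x \<otimes> (x \<otimes> y) = (\<iota> x \<otimes> x) \<otimes> y"
    by (simp add: m_assoc)
  also have "\<iota> x \<otimes> x = y \<otimes> \<iota> y"
    using assms mult_nonzero_iff by blast
  finally show ?thesis
    by (simp add: m_assoc)
qed

lemma iv_mult_nonzero_iff:
  assumes "a \<in> carrier Q" "b \<in> carrier Q"
  shows "\<not> is_zero Q (\<iota> a \<otimes> b) \<longleftrightarrow>
    \<not> is_zero Q a \<and> \<not> is_zero Q b \<and> a \<otimes> \<iota> a = b \<otimes> \<iota> b"
  using assms by (simp add: mult_nonzero_iff is_zero_iv_mult)

lemma mult_iv_mult_cancel:
  assumes "\<not> is_zero Q (\<iota> a \<otimes> b)" "a \<in> carrier Q" "b \<in> carrier Q"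
  shows "a \<otimes> (\<iota> a \<otimes> b) = b"
  using iv_mult_cancel[OF assms(1)] assms by simp

text \<open>For nonzero $p = a^{-1}b$ and $q = c^{-1}d$ one has $p^{-1}p = b^{-1}b$ and $qq^{-1} =
  c^{-1}c$. Equality of these two idempotents is also the criterion for $bc^{-1}$ to be
  nonzero.\<close>

lemma iv_mult_mult_nonzero_iff:
  assumes [simp]: "a \<in> carrier Q" "b \<in> carrier Q" "c \<in> carrier Q" "d \<in> carrier Q"
  shows "\<not> is_zero Q ((\<iota> a \<otimes> b) \<otimes> (\<iota> c \<otimes> d)) \<longleftrightarrow>
    \<not> is_zero Q (\<iota> a \<otimes> b) \<and> \<not> is_zero Q (\<iota> c \<otimes> d) \<and> \<not> is_zero Q (b \<otimes> \<iota> c)"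
proof -
  have "(\<iota> (\<iota> a \<otimes> b) \<otimes> (\<iota> a \<otimes> b) = (\<iota> c \<otimes> d) \<otimes> \<iota> (\<iota> c \<otimes> d)) \<longleftrightarrow> \<not> is_zero Q (b \<otimes> \<iota> c)"
    if n: "\<not> is_zero Q (\<iota> a \<otimes> b)" "\<not> is_zero Q (\<iota> c \<otimes> d)"
  proof -
    have n': "\<not> is_zero Q b" "\<not> is_zero Q c" "\<not> is_zero Q (\<iota> d \<otimes> c)"
      using n by (simp_all add: iv_mult_nonzero_iff)
    have "\<iota> (\<iota> a \<otimes> b) \<otimes> (\<iota> a \<otimes> b) = \<iota> b \<otimes> b"
      using mult_iv_mult_cancel[OF n(1)] by (simp add: iv_mult m_assoc)
    moreover have "(\<iota> c \<otimes> d) \<otimes> \<iota> (\<iota> c \<otimes> d) = \<iota> c \<otimes> c"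
      using mult_iv_mult_cancel[OF n'(3)] by (simp add: iv_mult m_assoc)
    ultimately show ?thesis
      using n' by (simp add: mult_nonzero_iff is_zero_iv_mult)
  qed
  then show ?thesis
    using mult_nonzero_iff[of "\<iota> a \<otimes> b" "\<iota> c \<otimes> d"] by auto
qed

text \<open>Expanding the inverse gives $a^{-1}y^{-1}yb$, where $y^{-1}yb = b$: a common left factor
  cancels from a quotient, as in a fraction.\<close>

lemma iv_mult_common_multiple:
  assumes "\<not> is_zero Q (y \<otimes> a)" "\<not> is_zero Q (y \<otimes> b)"
    and [simp]: "y \<in> carrier Q" "a \<in> carrier Q" "b \<in> carrier Q"
  shows "\<iota> (y \<otimes> a) \<otimes> (y \<otimes> b) = \<iota> a \<otimes> b"
  using iv_mult_cancel[OF assms(2)] by (simp add: iv_mult m_assoc)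

end

section \<open>One semigroup of quotients: zero, equality and products expressed in $S$\<close>

locale primitive_left_I_quotients = primitive_inverse_semigroup Q
  for Q :: "('a, 'q) monoid_scheme" (structure) +
  fixes S :: "('a, 's) monoid_scheme"
  assumes quotients: "semigroup_of_left_I_quotients Q S"
begin

lemma S_carrier [simp]: "s \<in> carrier S \<Longrightarrow> s \<in> carrier Q"
  using quotients by (auto simp: semigroup_of_left_I_quotients_def subsemigroup_def)

lemma S_mult: "s \<in> carrier S \<Longrightarrow> t \<in> carrier S \<Longrightarrow> s \<otimes>\<^bsub>S\<^esub> t = s \<otimes> t"
  using quotients by (auto simp: semigroup_of_left_I_quotients_def subsemigroup_def)

lemma S_closed [simp]:
  assumes "s \<in> carrier S" "t \<in> carrier S"
  shows "s \<otimes> t \<in> carrier S"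
proof -
  have "sgrp S"
    using quotients by (auto simp: semigroup_of_left_I_quotients_def subsemigroup_def)
  from sgrp.m_closed[OF this assms] show ?thesis
    using S_mult assms by simp
qed

lemma quotientE:
  assumes "q \<in> carrier Q"
  obtains a b where "a \<in> carrier S" "b \<in> carrier S" "q = \<iota> a \<otimes> b"
  using assms quotients by (auto simp: semigroup_of_left_I_quotients_def)

text \<open>If all elements of $S$ were nonzero in $Q$, so would be the products $aa$ and $ab$; then
  $aa^{-1} = a^{-1}a = bb^{-1}$ for all $a, b \in S$, so no quotient $a^{-1}b$ would vanish.\<close>

lemma zero_in_S: "\<exists>z\<in>carrier S. is_zero Q z"
proof (rule ccontr)
  assume no: "\<not> ?thesis"
  obtain z where z: "is_zero Q z" using ex_zero by blast
  then obtain a b where ab: "a \<in> carrier S" "b \<in> carrier S" "z = \<iota> a \<otimes> b"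
    by (metis quotientE is_zero_def)
  then have "\<not> is_zero Q (a \<otimes> a)" "\<not> is_zero Q (a \<otimes> b)" "\<not> is_zero Q a" "\<not> is_zero Q b"
    using no S_closed by blast+
  then have "\<not> is_zero Q (\<iota> a \<otimes> b)"
    using ab by (simp add: mult_nonzero_iff is_zero_iv_mult)
  then show False using z ab by simp
qed

text \<open>Since the zero of $Q$ lies in $S$, it is also the only zero of $S$. Nonvanishing of an
  element of $S$ thus becomes a condition that does not mention $Q$.\<close>

lemma is_zero_S_iff:
  assumes "s \<in> carrier S"
  shows "is_zero S s \<longleftrightarrow> is_zero Q s"
proof
  show "is_zero S s" if "is_zero Q s"
    using that assms by (simp add: is_zero_def S_mult)
next
  assume s: "is_zero S s"
  obtain z where z: "z \<in> carrier S" "is_zero Q z" using zero_in_S by blast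
  have "s = s \<otimes> z"
    using s z assms by (metis is_zero_def S_mult)
  also have "\<dots> = z"
    using z assms by (simp add: is_zero_def)
  finally show "is_zero Q s" using z by simp
qed

text \<open>Write $s^{-1} = x^{-1}y$ as a quotient. Then $s^{-1}s = x^{-1}(ys)$ is nonzero, and so
  is its factor $ys$.\<close>

lemma nonzero_left_multiplier:
  assumes "s \<in> carrier S" "\<not> is_zero Q s"
  obtains y where "y \<in> carrier S" "\<not> is_zero Q (y \<otimes> s)"
proof -
  obtain x y where xy: "x \<in> carrier S" "y \<in> carrier S" "\<iota> s = \<iota> x \<otimes> y"
    using assms by (metis quotientE S_carrier iv_closed)
  have "\<not> is_zero Q (\<iota> s \<otimes> s)"
    using assms by (simp add: is_zero_iv_mult)
  also have "\<iota> s \<otimes> s = \<iota> x \<otimes> (y \<otimes> s)"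
    using xy assms by (simp add: m_assoc)
  finally have "\<not> is_zero Q (y \<otimes> s)"
    using is_zero_mult xy by auto
  then show ?thesis using that xy by blast
qed

text \<open>An instance of \<open>iv_mult_cancel\<close>, with the condition on $y$ and the
  numerator stated in $S$, so that the same representation serves for every $Q$.\<close>

lemma element_eq_quotient:
  assumes "s \<in> carrier S" "y \<in> carrier S" "\<not> is_zero S (y \<otimes>\<^bsub>S\<^esub> s)"
  shows "s = \<iota> y \<otimes> (y \<otimes>\<^bsub>S\<^esub> s)"
  using assms by (simp add: S_mult is_zero_S_iff iv_mult_cancel)

text \<open>Both sides say that $a$ and $b$ are nonzero with $aa^{-1} = bb^{-1}$: a multiplier $x$
  with $xa$ and $xb$ nonzero has $x^{-1}x$ equal to both idempotents. Conversely, a multiplier that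
  does not annihilate $a$ does not annihilate $b$ either.\<close>

lemma quotient_nonzero_iff:
  assumes ab: "a \<in> carrier S" "b \<in> carrier S"
  shows "\<not> is_zero Q (\<iota> a \<otimes> b) \<longleftrightarrow>
    (\<exists>x\<in>carrier S. \<not> is_zero S (x \<otimes>\<^bsub>S\<^esub> a) \<and> \<not> is_zero S (x \<otimes>\<^bsub>S\<^esub> b))" (is "?L \<longleftrightarrow> ?R")
proof
  assume ?L
  then have n: "\<not> is_zero Q a" "\<not> is_zero Q b" "a \<otimes> \<iota> a = b \<otimes> \<iota> b"
    using ab by (simp_all add: iv_mult_nonzero_iff)
  obtain y where y: "y \<in> carrier S" "\<not> is_zero Q (y \<otimes> a)"
    using nonzero_left_multiplier ab(1) n(1) .
  then have "\<not> is_zero Q (y \<otimes> b)"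
    using n ab by (simp add: mult_nonzero_iff)
  then show ?R
    using y ab by (auto simp: is_zero_S_iff S_mult)
next
  assume ?R
  then obtain x where "x \<in> carrier S" "\<not> is_zero Q (x \<otimes> a)" "\<not> is_zero Q (x \<otimes> b)"
    using ab by (auto simp: is_zero_S_iff S_mult)
  then show ?L
    using ab by (simp add: mult_nonzero_iff is_zero_iv_mult)
qed

text \<open>Writing $bc^{-1} = x^{-1}y$ and cancelling $x$ gives $xbc^{-1} = y$. Multiplication by
  $c$ on the right then yields the common left multiple, because $c^{-1}c = b^{-1}b$ is absorbed by
  $b$.\<close>

lemma mult_iv_nonzero_imp_common_multiple:
  assumes "\<not> is_zero Q (b \<otimes> \<iota> c)" and bc: "b \<in> carrier S" "c \<in> carrier S"
  obtains x y where "x \<in> carrier S" "y \<in> carrier S" "b \<otimes> \<iota> c = \<iota> x \<otimes> y"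
    "x \<otimes> b = y \<otimes> c" "\<not> is_zero Q (x \<otimes> b)"
proof -
  obtain x y where xy: "x \<in> carrier S" "y \<in> carrier S" "b \<otimes> \<iota> c = \<iota> x \<otimes> y"
    using quotientE bc by (metis S_carrier m_closed iv_closed)
  have lb: "\<iota> b \<otimes> b = \<iota> c \<otimes> c" and "\<not> is_zero Q c"
    using assms by (simp_all add: mult_nonzero_iff is_zero_iv_mult)
  have xyn: "\<not> is_zero Q (\<iota> x \<otimes> y)" using assms(1) xy by simp
  have "x \<otimes> (b \<otimes> \<iota> c) = y"
    using iv_mult_cancel[OF xyn] xy by simp
  then have 1: "y \<otimes> c = x \<otimes> (b \<otimes> (\<iota> c \<otimes> c))" "x \<otimes> b \<otimes> \<iota> c = y"
    using xy(1) bc by (auto simp: m_assoc)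
  then have "x \<otimes> b = y \<otimes> c"
    using bc by (simp flip: lb)
  moreover have "\<not> is_zero Q y"
    using xyn xy by (simp add: iv_mult_nonzero_iff)
  then have "\<not> is_zero Q (x \<otimes> b)"
    using 1 is_zero_mult bc by (metis S_carrier iv_closed)
  ultimately show ?thesis using that xy by blast
qed

text \<open>Cancelling $x$ gives $b = x^{-1}yc$, and $yc$ nonzero means that $cc^{-1} = y^{-1}y$,
  which $y$ absorbs.\<close>

lemma mult_iv_eq_if_common_multiple:
  assumes "x \<otimes> b = y \<otimes> c" "\<not> is_zero Q (x \<otimes> b)"
    and [simp]: "x \<in> carrier S" "y \<in> carrier S" "b \<in> carrier S" "c \<in> carrier S"
  shows "b \<otimes> \<iota> c = \<iota> x \<otimes> y" "\<not> is_zero Q (b \<otimes> \<iota> c)"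
proof -
  have b: "b = \<iota> x \<otimes> (y \<otimes> c)"
    using assms iv_mult_cancel[of x b] by simp
  have "\<not> is_zero Q (y \<otimes> c)" using assms by simp
  then have "\<iota> y \<otimes> y = c \<otimes> \<iota> c"
    by (simp add: mult_nonzero_iff)
  then have "y \<otimes> (c \<otimes> \<iota> c) = y"
    by (metis mult_iv_mult S_carrier assms(4))
  then show eq: "b \<otimes> \<iota> c = \<iota> x \<otimes> y"
    by (subst b) (simp add: m_assoc)
  \<comment> \<open>As $b$ is recovered from $bc^{-1}$ and is nonzero, $bc^{-1}$ cannot
    vanish.\<close>
  have "b \<otimes> \<iota> c \<otimes> c = b"
    by (subst (2) b, subst eq) (simp add: m_assoc)
  then show "\<not> is_zero Q (b \<otimes> \<iota> c)"
    using assms is_zero_mult by (metis S_carrier)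
qed

text \<open>Two nonzero fractions agree exactly when they can be expanded to the same numerator and
  denominator. For the forward direction, $ca^{-1}b = d$ shows that $ca^{-1}$ is nonzero, which
  supplies $x$ and $y$ with $xc = ya$; then $xd = xca^{-1}b = yaa^{-1}b = yb$. The converse cancels
  $x$ and $y$.\<close>

lemma nonzero_quotient_eq_iff:
  assumes ab: "a \<in> carrier S" "b \<in> carrier S" and cd: "c \<in> carrier S" "d \<in> carrier S"
  shows "\<iota> a \<otimes> b = \<iota> c \<otimes> d \<and> \<not> is_zero Q (\<iota> a \<otimes> b) \<longleftrightarrow>
    (\<exists>x\<in>carrier S. \<exists>y\<in>carrier S. x \<otimes>\<^bsub>S\<^esub> c = y \<otimes>\<^bsub>S\<^esub> a \<and> x \<otimes>\<^bsub>S\<^esub> d = y \<otimes>\<^bsub>S\<^esub> b \<and>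
      \<not> is_zero S (x \<otimes>\<^bsub>S\<^esub> c) \<and> \<not> is_zero S (x \<otimes>\<^bsub>S\<^esub> d))" (is "?L \<longleftrightarrow> ?R")
proof
  assume ?L
  then have eq: "\<iota> a \<otimes> b = \<iota> c \<otimes> d" and n: "\<not> is_zero Q (\<iota> c \<otimes> d)" by auto
  then have rc: "c \<otimes> \<iota> c = d \<otimes> \<iota> d"
    using cd by (simp add: iv_mult_nonzero_iff)
  have d: "c \<otimes> \<iota> a \<otimes> b = d"
    using iv_mult_cancel[OF n] cd ab by (simp add: m_assoc eq)
  moreover have nd: "\<not> is_zero Q d"
    using n cd by (simp add: iv_mult_nonzero_iff)
  ultimately have "\<not> is_zero Q (c \<otimes> \<iota> a)"
    using is_zero_mult ab by (metis S_carrier)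
  then obtain x y where xy: "x \<in> carrier S" "y \<in> carrier S" "c \<otimes> \<iota> a = \<iota> x \<otimes> y"
    "x \<otimes> c = y \<otimes> a" "\<not> is_zero Q (x \<otimes> c)"
    using cd(1) ab(1) by (rule mult_iv_nonzero_imp_common_multiple)
  \<comment> \<open>Since $cc^{-1} = dd^{-1}$, the multiplier $x$ treats $c$ and $d$ alike.\<close>
  have xd: "\<not> is_zero Q (x \<otimes> d)"
    using xy(1,5) nd cd rc by (simp add: mult_nonzero_iff)
  have "x \<otimes> d = y \<otimes> (a \<otimes> (\<iota> a \<otimes> b))"
    using d xy(4) by (metis m_assoc S_carrier iv_closed m_closed ab cd(1) xy(1,2))
  also have "a \<otimes> (\<iota> a \<otimes> b) = b"
    using \<open>?L\<close> mult_iv_mult_cancel[OF _ S_carrier S_carrier, OF _ ab] by blast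
  finally have "x \<otimes> d = y \<otimes> b" .
  then have "x \<otimes>\<^bsub>S\<^esub> c = y \<otimes>\<^bsub>S\<^esub> a \<and> x \<otimes>\<^bsub>S\<^esub> d = y \<otimes>\<^bsub>S\<^esub> b \<and>
      \<not> is_zero S (x \<otimes>\<^bsub>S\<^esub> c) \<and> \<not> is_zero S (x \<otimes>\<^bsub>S\<^esub> d)"
    using xy xd ab cd by (simp add: S_mult is_zero_S_iff)
  then show ?R
    using xy(1,2) by blast
next
  assume ?R
  then obtain x y where xy: "x \<in> carrier S" "y \<in> carrier S" "x \<otimes> c = y \<otimes> a" "x \<otimes> d = y \<otimes> b"
    "\<not> is_zero Q (x \<otimes> c)" "\<not> is_zero Q (x \<otimes> d)"
    using ab cd by (auto simp: S_mult is_zero_S_iff)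
  have "\<iota> c \<otimes> d = \<iota> (x \<otimes> c) \<otimes> (x \<otimes> d)"
    using xy(1,5,6) cd by (simp add: iv_mult_common_multiple)
  also have "\<dots> = \<iota> (y \<otimes> a) \<otimes> (y \<otimes> b)" using xy by simp
  also have "\<dots> = \<iota> a \<otimes> b"
    using xy ab by (intro iv_mult_common_multiple) simp_all
  finally have "\<iota> a \<otimes> b = \<iota> c \<otimes> d" by simp
  moreover have "\<not> is_zero Q (\<iota> c \<otimes> d)"
    using xy(1,5,6) cd by (simp add: mult_nonzero_iff is_zero_iv_mult)
  ultimately show ?L by simp
qed

text \<open>By \<open>iv_mult_mult_nonzero_iff\<close> only $bc^{-1}$ has to be tested, and it is
  nonzero exactly when $b$ and $c$ have a nonzero common left multiple in $S$.\<close>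

lemma quotient_mult_nonzero_iff:
  assumes abcd: "a \<in> carrier S" "b \<in> carrier S" "c \<in> carrier S" "d \<in> carrier S"
  shows "\<not> is_zero Q ((\<iota> a \<otimes> b) \<otimes> (\<iota> c \<otimes> d)) \<longleftrightarrow>
    \<not> is_zero Q (\<iota> a \<otimes> b) \<and> \<not> is_zero Q (\<iota> c \<otimes> d) \<and>
    (\<exists>x\<in>carrier S. \<exists>y\<in>carrier S. x \<otimes>\<^bsub>S\<^esub> b = y \<otimes>\<^bsub>S\<^esub> c \<and> \<not> is_zero S (x \<otimes>\<^bsub>S\<^esub> b))"
    (is "?L \<longleftrightarrow> ?R")
proof
  assume ?L
  then have n: "\<not> is_zero Q (\<iota> a \<otimes> b)" "\<not> is_zero Q (\<iota> c \<otimes> d)" "\<not> is_zero Q (b \<otimes> \<iota> c)"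
    using iv_mult_mult_nonzero_iff abcd by auto
  obtain x y where "x \<in> carrier S" "y \<in> carrier S" "b \<otimes> \<iota> c = \<iota> x \<otimes> y"
    "x \<otimes> b = y \<otimes> c" "\<not> is_zero Q (x \<otimes> b)"
    using n(3) abcd(2,3) by (rule mult_iv_nonzero_imp_common_multiple)
  then have "x \<in> carrier S \<and> y \<in> carrier S \<and> x \<otimes>\<^bsub>S\<^esub> b = y \<otimes>\<^bsub>S\<^esub> c \<and> \<not> is_zero S (x \<otimes>\<^bsub>S\<^esub> b)"
    using abcd by (simp add: S_mult is_zero_S_iff)
  then show ?R
    using n by blast
next
  assume ?R
  then obtain x y where "x \<in> carrier S" "y \<in> carrier S"
    "x \<otimes>\<^bsub>S\<^esub> b = y \<otimes>\<^bsub>S\<^esub> c" "\<not> is_zero S (x \<otimes>\<^bsub>S\<^esub> b)"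
    by blast
  then have "\<not> is_zero Q (b \<otimes> \<iota> c)"
    using mult_iv_eq_if_common_multiple(2)[of x b y c] abcd by (simp add: S_mult is_zero_S_iff)
  then show ?L
    using \<open>?R\<close> iv_mult_mult_nonzero_iff abcd by auto
qed

text \<open>Replacing $bc^{-1}$ by $x^{-1}y$ turns the product into $a^{-1}x^{-1}yd$, which is again
  a single quotient.\<close>

lemma quotient_mult_eq:
  assumes "x \<otimes>\<^bsub>S\<^esub> b = y \<otimes>\<^bsub>S\<^esub> c" "\<not> is_zero S (x \<otimes>\<^bsub>S\<^esub> b)"
    and S: "x \<in> carrier S" "y \<in> carrier S"
      "a \<in> carrier S" "b \<in> carrier S" "c \<in> carrier S" "d \<in> carrier S"
  shows "(\<iota> a \<otimes> b) \<otimes> (\<iota> c \<otimes> d) = \<iota> (x \<otimes>\<^bsub>S\<^esub> a) \<otimes> (y \<otimes>\<^bsub>S\<^esub> d)"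
proof -
  have "(\<iota> a \<otimes> b) \<otimes> (\<iota> c \<otimes> d) = \<iota> a \<otimes> ((b \<otimes> \<iota> c) \<otimes> d)"
    using S by (simp add: m_assoc)
  also have "b \<otimes> \<iota> c = \<iota> x \<otimes> y"
    using assms mult_iv_eq_if_common_multiple by (simp add: S_mult is_zero_S_iff)
  also have "\<iota> a \<otimes> (\<iota> x \<otimes> y \<otimes> d) = \<iota> (x \<otimes>\<^bsub>S\<^esub> a) \<otimes> (y \<otimes>\<^bsub>S\<^esub> d)"
    using S by (simp add: m_assoc S_mult iv_mult)
  finally show ?thesis .
qed

end

section \<open>Transfer between two semigroups of quotients of the same $S$\<close>

locale two_primitive_left_I_quotients =
  Q1: primitive_left_I_quotients Q1 S + Q2: primitive_left_I_quotients Q2 S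
  for Q1 :: "('a, 'q1) monoid_scheme" and Q2 :: "('a, 'q2) monoid_scheme"
    and S :: "('a, 's) monoid_scheme"
begin

lemma quotient_is_zero_iff:
  assumes "a \<in> carrier S" "b \<in> carrier S"
  shows "is_zero Q1 (sg_inv Q1 a \<otimes>\<^bsub>Q1\<^esub> b) \<longleftrightarrow> is_zero Q2 (sg_inv Q2 a \<otimes>\<^bsub>Q2\<^esub> b)"
  using Q1.quotient_nonzero_iff[OF assms] Q2.quotient_nonzero_iff[OF assms] by blast

text \<open>For nonzero quotients the criterion of \<open>nonzero_quotient_eq_iff\<close> reads the
  same in both semigroups. The zero case is separate: there, equality means that both quotients
  vanish.\<close>

lemma quotient_eq_transfer:
  assumes S: "a \<in> carrier S" "b \<in> carrier S" "c \<in> carrier S" "d \<in> carrier S"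
  shows "sg_inv Q1 a \<otimes>\<^bsub>Q1\<^esub> b = sg_inv Q1 c \<otimes>\<^bsub>Q1\<^esub> d \<longleftrightarrow>
    sg_inv Q2 a \<otimes>\<^bsub>Q2\<^esub> b = sg_inv Q2 c \<otimes>\<^bsub>Q2\<^esub> d"
    (is "?p1 = ?p1' \<longleftrightarrow> ?p2 = ?p2'")
proof (cases "is_zero Q1 ?p1")
  case True
  then have "?p1 = ?p1' \<longleftrightarrow> is_zero Q1 ?p1'"
    using Q1.is_zero_unique by metis
  also have "\<dots> \<longleftrightarrow> is_zero Q2 ?p2'"
    by (rule quotient_is_zero_iff[OF S(3,4)])
  also have "\<dots> \<longleftrightarrow> ?p2 = ?p2'"
    using True quotient_is_zero_iff[OF S(1,2)] Q2.is_zero_unique by metis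
  finally show ?thesis .
next
  case False
  have "?p1 = ?p1' \<and> \<not> is_zero Q1 ?p1 \<longleftrightarrow> ?p2 = ?p2' \<and> \<not> is_zero Q2 ?p2"
    by (simp only: Q1.nonzero_quotient_eq_iff[OF S] Q2.nonzero_quotient_eq_iff[OF S])
  then show ?thesis
    using False quotient_is_zero_iff[OF S(1,2)] by simp
qed

text \<open>The point is that one pair $u, v$ serves both semigroups. If the products are nonzero,
  $u = xa$ and $v = yd$ come from a common left multiple $xb = yc$ in $S$.\<close>

lemma quotient_mult_transfer:
  assumes S: "a \<in> carrier S" "b \<in> carrier S" "c \<in> carrier S" "d \<in> carrier S"
  obtains u v where "u \<in> carrier S" "v \<in> carrier S"
    "(sg_inv Q1 a \<otimes>\<^bsub>Q1\<^esub> b) \<otimes>\<^bsub>Q1\<^esub> (sg_inv Q1 c \<otimes>\<^bsub>Q1\<^esub> d) = sg_inv Q1 u \<otimes>\<^bsub>Q1\<^esub> v"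
    "(sg_inv Q2 a \<otimes>\<^bsub>Q2\<^esub> b) \<otimes>\<^bsub>Q2\<^esub> (sg_inv Q2 c \<otimes>\<^bsub>Q2\<^esub> d) = sg_inv Q2 u \<otimes>\<^bsub>Q2\<^esub> v"
proof (cases "is_zero Q1 ((sg_inv Q1 a \<otimes>\<^bsub>Q1\<^esub> b) \<otimes>\<^bsub>Q1\<^esub> (sg_inv Q1 c \<otimes>\<^bsub>Q1\<^esub> d))")
  case True
  then have True': "is_zero Q2 ((sg_inv Q2 a \<otimes>\<^bsub>Q2\<^esub> b) \<otimes>\<^bsub>Q2\<^esub> (sg_inv Q2 c \<otimes>\<^bsub>Q2\<^esub> d))"
    using Q1.quotient_mult_nonzero_iff[OF S] Q2.quotient_mult_nonzero_iff[OF S]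
      quotient_is_zero_iff[OF S(1,2)] quotient_is_zero_iff[OF S(3,4)] by blast
  \<comment> \<open>Both products vanish, so the zero $z$ of $S$ represents them as $z^{-1}z$ on
    either side.\<close>
  obtain z where z: "z \<in> carrier S" "is_zero Q1 z" using Q1.zero_in_S by blast
  then have z': "is_zero Q2 z" using Q1.is_zero_S_iff Q2.is_zero_S_iff by blast
  have "is_zero Q1 (sg_inv Q1 z \<otimes>\<^bsub>Q1\<^esub> z)" "is_zero Q2 (sg_inv Q2 z \<otimes>\<^bsub>Q2\<^esub> z)"
    using z z' by (simp_all add: Q1.is_zero_iv_mult Q2.is_zero_iv_mult)
  then show ?thesis
    using that[OF z(1) z(1)] True True' Q1.is_zero_unique Q2.is_zero_unique by blast
next
  case False
  then obtain x y where xy: "x \<in> carrier S" "y \<in> carrier S"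
    "x \<otimes>\<^bsub>S\<^esub> b = y \<otimes>\<^bsub>S\<^esub> c" "\<not> is_zero S (x \<otimes>\<^bsub>S\<^esub> b)"
    using Q1.quotient_mult_nonzero_iff[OF S] by blast
  have "x \<otimes>\<^bsub>S\<^esub> a \<in> carrier S" "y \<otimes>\<^bsub>S\<^esub> d \<in> carrier S"
    using xy S by (simp_all add: Q1.S_mult)
  then show ?thesis
    using that Q1.quotient_mult_eq[OF xy(3,4,1,2) S] Q2.quotient_mult_eq[OF xy(3,4,1,2) S]
    by blast
qed

text \<open>A zero $s$ equals $s^{-1}s$ in both semigroups; a nonzero $s$ equals $y^{-1}(ys)$ for
  any $y$ in $S$ with $ys$ nonzero.\<close>

lemma element_common_quotient:
  assumes "s \<in> carrier S"
  obtains a b where "a \<in> carrier S" "b \<in> carrier S"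
    "s = sg_inv Q1 a \<otimes>\<^bsub>Q1\<^esub> b" "s = sg_inv Q2 a \<otimes>\<^bsub>Q2\<^esub> b"
proof (cases "is_zero Q1 s")
  case True
  then have "is_zero Q2 s" using assms Q1.is_zero_S_iff Q2.is_zero_S_iff by blast
  with True have "is_zero Q1 (sg_inv Q1 s \<otimes>\<^bsub>Q1\<^esub> s)" "is_zero Q2 (sg_inv Q2 s \<otimes>\<^bsub>Q2\<^esub> s)"
    using assms by (simp_all add: Q1.is_zero_iv_mult Q2.is_zero_iv_mult)
  then show ?thesis
    using that[OF assms assms] True \<open>is_zero Q2 s\<close> Q1.is_zero_unique Q2.is_zero_unique by blast
next
  case False
  then obtain y where y: "y \<in> carrier S" "\<not> is_zero Q1 (y \<otimes>\<^bsub>Q1\<^esub> s)"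
    using Q1.nonzero_left_multiplier assms by blast
  then have "\<not> is_zero S (y \<otimes>\<^bsub>S\<^esub> s)" "y \<otimes>\<^bsub>S\<^esub> s \<in> carrier S"
    using assms by (simp_all add: Q1.S_mult Q1.is_zero_S_iff)
  then show ?thesis
    using that y(1) Q1.element_eq_quotient Q2.element_eq_quotient assms by blast
qed

section \<open>The isomorphism fixing $S$\<close>

definition quotient_map :: "'a \<Rightarrow> 'a" where
  "quotient_map p = (THE q. \<exists>a\<in>carrier S. \<exists>b\<in>carrier S.
    p = sg_inv Q1 a \<otimes>\<^bsub>Q1\<^esub> b \<and> q = sg_inv Q2 a \<otimes>\<^bsub>Q2\<^esub> b)"

text \<open>The description in \<open>quotient_map_def\<close> is unique because, by
  \<open>quotient_eq_transfer\<close>, representations of one element of \<open>Q1\<close> also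
  agree in \<open>Q2\<close>.\<close>

lemma quotient_map_quotient:
  assumes "a \<in> carrier S" "b \<in> carrier S"
  shows "quotient_map (sg_inv Q1 a \<otimes>\<^bsub>Q1\<^esub> b) = sg_inv Q2 a \<otimes>\<^bsub>Q2\<^esub> b"
  unfolding quotient_map_def
proof (rule the_equality)
  show "\<exists>c\<in>carrier S. \<exists>d\<in>carrier S. sg_inv Q1 a \<otimes>\<^bsub>Q1\<^esub> b = sg_inv Q1 c \<otimes>\<^bsub>Q1\<^esub> d \<and>
      sg_inv Q2 a \<otimes>\<^bsub>Q2\<^esub> b = sg_inv Q2 c \<otimes>\<^bsub>Q2\<^esub> d"
    using assms by blast
qed (use assms quotient_eq_transfer in metis)

lemma quotient_map_iso: "quotient_map \<in> iso Q1 Q2"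
proof -
  have "quotient_map \<in> hom Q1 Q2"
  proof (rule homI)
    fix p assume "p \<in> carrier Q1"
    then obtain a b where "a \<in> carrier S" "b \<in> carrier S" "p = sg_inv Q1 a \<otimes>\<^bsub>Q1\<^esub> b"
      by (rule Q1.quotientE)
    then show "quotient_map p \<in> carrier Q2" by (simp add: quotient_map_quotient)
  next
    fix p p' assume pQ: "p \<in> carrier Q1" and p'Q: "p' \<in> carrier Q1"
    from pQ obtain a b where ab: "a \<in> carrier S" "b \<in> carrier S"
      and p: "p = sg_inv Q1 a \<otimes>\<^bsub>Q1\<^esub> b"
      by (rule Q1.quotientE)
    from p'Q obtain c d where cd: "c \<in> carrier S" "d \<in> carrier S"
      and p': "p' = sg_inv Q1 c \<otimes>\<^bsub>Q1\<^esub> d"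
      by (rule Q1.quotientE)
    obtain u v where uv: "u \<in> carrier S" "v \<in> carrier S"
      "(sg_inv Q1 a \<otimes>\<^bsub>Q1\<^esub> b) \<otimes>\<^bsub>Q1\<^esub> (sg_inv Q1 c \<otimes>\<^bsub>Q1\<^esub> d) = sg_inv Q1 u \<otimes>\<^bsub>Q1\<^esub> v"
      "(sg_inv Q2 a \<otimes>\<^bsub>Q2\<^esub> b) \<otimes>\<^bsub>Q2\<^esub> (sg_inv Q2 c \<otimes>\<^bsub>Q2\<^esub> d) = sg_inv Q2 u \<otimes>\<^bsub>Q2\<^esub> v"
      using ab cd by (rule quotient_mult_transfer)
    show "quotient_map (p \<otimes>\<^bsub>Q1\<^esub> p') = quotient_map p \<otimes>\<^bsub>Q2\<^esub> quotient_map p'"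
      unfolding p p' uv(3) using ab cd uv by (simp add: quotient_map_quotient)
  qed
  moreover have "inj_on quotient_map (carrier Q1)"
    by (rule inj_onI) (metis Q1.quotientE quotient_map_quotient quotient_eq_transfer)
  moreover have "carrier Q2 \<subseteq> quotient_map ` carrier Q1"
  proof
    fix q assume "q \<in> carrier Q2"
    then obtain a b where S: "a \<in> carrier S" "b \<in> carrier S" "q = sg_inv Q2 a \<otimes>\<^bsub>Q2\<^esub> b"
      by (rule Q2.quotientE)
    then show "q \<in> quotient_map ` carrier Q1"
      by (intro image_eqI[of _ _ "sg_inv Q1 a \<otimes>\<^bsub>Q1\<^esub> b"]) (simp_all add: quotient_map_quotient)
  qed
  ultimately show ?thesis
    by (auto simp: iso_def bij_betw_def hom_def)
qed

lemma quotient_map_id: "s \<in> carrier S \<Longrightarrow> quotient_map s = s"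
  by (metis element_common_quotient quotient_map_quotient)

end

theorem corollary4p4:
  fixes S :: "('a, 's) monoid_scheme"
    and Q1 :: "('a, 'q1) monoid_scheme"
    and Q2 :: "('a, 'q2) monoid_scheme"
  assumes "sgrp S"
    and "primitive_inverse_semigroup Q1"
    and "semigroup_of_left_I_quotients Q1 S"
    and "primitive_inverse_semigroup Q2"
    and "semigroup_of_left_I_quotients Q2 S"
  shows "\<exists>\<phi>. \<phi> \<in> iso Q1 Q2 \<and> (\<forall>s\<in>carrier S. \<phi> s = s)"
proof -
  interpret two_primitive_left_I_quotients Q1 Q2 S
    using assms by (simp add: two_primitive_left_I_quotients_def primitive_left_I_quotients_def
        primitive_left_I_quotients_axioms_def)
  show ?thesis
    using quotient_map_iso quotient_map_id by blast
qed

end
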